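(* Let $T\in\mathbb{R}^{2\times2}$ be positive. Then the following assertions are equivalent. (i) $T$ is embeddable into a positive semigroup, i.e., there is a positive strongly continuous semigroup $(T(t))_{t\ge0}$ of $2\times 2$ matrices with $T(1)=T$. (ii) $T$ is invertible and has a positive square root, i.e., there is a positive $S\in\mathbb{R}^{2\times2}$ with $S^2=T$. (iii) $\sigma(T)\subseteq(0,\infty)$. (iv) $\det T>0$.
   Context: A matrix is positive if all its entries are $\ge0$. A semigroup $(T(t))_{t\ge0}$ of matrices (with $T(0)=I$, $T(t+s)=T(t)T(s)$, continuous in $t$) is positive if every $T(t)$ is positive. $\sigma(T)$ denotes the set of (complex) eigenvalues of $T$. *)

theory Defs
  imports "HOL-Analysis.Analysis"
begin

text \<open>Positivity of matrices is entrywise nonnegativity (the zero matrix is positive).\<close>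

definition positive_matrix :: "real ^ 'n ^ 'm \<Rightarrow> bool" where
  "positive_matrix A \<longleftrightarrow> (\<forall>i j. 0 \<le> A $ i $ j)"

text \<open>Only the values at nonnegative times matter. In finite dimension strong continuity
  is continuity for the topology of the matrix space. At time 0 it is one-sided.\<close>

definition matrix_semigroup :: "(real \<Rightarrow> real ^ 'n ^ 'n) \<Rightarrow> bool" where
  "matrix_semigroup S \<longleftrightarrow>
     S 0 = mat 1 \<and>
     (\<forall>t\<ge>0. \<forall>s\<ge>0. S (t + s) = S t ** S s) \<and>
     continuous_on {0..} S"

definition positive_semigroup :: "(real \<Rightarrow> real ^ 'n ^ 'n) \<Rightarrow> bool" where
  "positive_semigroup S \<longleftrightarrow> matrix_semigroup S \<and> (\<forall>t\<ge>0. positive_matrix (S t))"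

text \<open>The spectrum includes the non-real eigenvalues, so a real matrix has to act on
  complex vectors.\<close>

definition complex_eigenvalues :: "real ^ 'n ^ 'n \<Rightarrow> complex set" where
  "complex_eigenvalues A =
     {z. \<exists>v :: complex ^ 'n. v \<noteq> 0 \<and> map_matrix complex_of_real A *v v = z *s v}"

end

theory Submission
  imports Defs
begin

text \<open>A positive two-by-two matrix \<open>T\<close> has real eigenvalues \<open>l\<^sub>2 \<le> l\<^sub>1\<close>, because its
  off-diagonal entries have a nonnegative product and so the discriminant of the characteristic
  polynomial is nonnegative. Their sum, the trace, is nonnegative, so they are both positive as
  soon as their product \<open>det T\<close> is. This makes the spectral condition equivalent to
  \<open>det T > 0\<close> (\<open>positive_spectrum_iff_det_pos_2x2\<close>).

  The other conditions are linked in a cycle. A semigroup provides the square root \<open>S (1/2)\<close>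
  of \<open>S 1\<close>, and all its members are invertible since they are powers of members close to the
  identity (\<open>matrix_semigroup_invertible\<close>). The determinant of an invertible square \<open>R\<^sup>2\<close> is
  the positive number \<open>(det R)\<^sup>2\<close>.

  The substantial step is to embed \<open>T\<close> when \<open>det T > 0\<close>
  (\<open>embeddable_if_det_pos_2x2\<close>). The matrix \<open>M = T - l\<^sub>2 I\<close>, shifted by the smaller
  eigenvalue, is again positive: the characteristic polynomial at \<open>l\<^sub>2\<close> shows that its diagonal
  entries have a nonnegative product, and their sum is \<open>l\<^sub>1 - l\<^sub>2 \<ge> 0\<close>. By the Cayley-Hamilton
  theorem \<open>M\<^sup>2 = (l\<^sub>1 - l\<^sub>2) M\<close>. Therefore every power of \<open>T = l\<^sub>2 I + M\<close> is a combination of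
  \<open>I\<close> and \<open>M\<close>, and the coefficients interpolate to real exponents \<open>t \<ge> 0\<close> as nonnegative
  functions of \<open>t\<close>. Positivity of the semigroup can then be read off.\<close>

section \<open>The spectrum of a two-by-two matrix\<close>

lemma complex_eigenvalues_char_poly:
  fixes A :: "real ^ 'n ^ 'n"
  shows "z \<in> complex_eigenvalues A \<longleftrightarrow> det (map_matrix complex_of_real A - mat z) = 0"
proof -
  let ?B = "map_matrix complex_of_real A"
  have kernel: "?B *v v = z *s v \<longleftrightarrow> (?B - mat z) *v v = 0" for v
  proof -
    have "mat z *v v = z *s v"
      by (simp add: vec_eq_iff matrix_vector_mult_def mat_def if_distrib if_distribR sum.delta' cong: if_cong)
    then show ?thesis
      by (simp add: matrix_vector_mult_diff_rdistrib)
  qed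
  have "z \<in> complex_eigenvalues A \<longleftrightarrow> \<not> (\<forall>v. (?B - mat z) *v v = 0 \<longrightarrow> v = 0)"
    by (auto simp: complex_eigenvalues_def kernel)
  also have "\<dots> \<longleftrightarrow> \<not> invertible (?B - mat z)"
    by (simp add: matrix_left_invertible_ker[symmetric] invertible_left_inverse)
  finally show ?thesis
    by (simp add: invertible_det_nz)
qed

text \<open>The discriminant of the characteristic polynomial is
  \<open>(A\<^sub>1\<^sub>1 - A\<^sub>2\<^sub>2)\<^sup>2 + 4 A\<^sub>1\<^sub>2 A\<^sub>2\<^sub>1\<close>, which the hypothesis makes nonnegative, so that both
  eigenvalues are real. Later arguments only look at their signs, for which the sum and the
  product are more convenient than the quadratic formula.\<close>

lemma complex_eigenvalues_2x2:
  fixes A :: "real ^ 2 ^ 2"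
  assumes "0 \<le> A $ 1 $ 2 * A $ 2 $ 1"
  obtains l\<^sub>1 l\<^sub>2 :: real where "l\<^sub>2 \<le> l\<^sub>1" "l\<^sub>1 + l\<^sub>2 = A $ 1 $ 1 + A $ 2 $ 2" "l\<^sub>1 * l\<^sub>2 = det A"
    "complex_eigenvalues A = {complex_of_real l\<^sub>1, complex_of_real l\<^sub>2}"
proof -
  define r where "r = sqrt ((A $ 1 $ 1 - A $ 2 $ 2)\<^sup>2 + 4 * (A $ 1 $ 2 * A $ 2 $ 1))"
  define l\<^sub>1 where "l\<^sub>1 = (A $ 1 $ 1 + A $ 2 $ 2 + r) / 2"
  define l\<^sub>2 where "l\<^sub>2 = (A $ 1 $ 1 + A $ 2 $ 2 - r) / 2"
  have r: "0 \<le> r" "r\<^sup>2 = (A $ 1 $ 1 - A $ 2 $ 2)\<^sup>2 + 4 * (A $ 1 $ 2 * A $ 2 $ 1)"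
    using assms by (auto simp: r_def)
  have order: "l\<^sub>2 \<le> l\<^sub>1" and trace: "l\<^sub>1 + l\<^sub>2 = A $ 1 $ 1 + A $ 2 $ 2"
    using r(1) by (auto simp: l\<^sub>1_def l\<^sub>2_def field_simps)
  have "l\<^sub>1 * l\<^sub>2 = ((A $ 1 $ 1 + A $ 2 $ 2)\<^sup>2 - r\<^sup>2) / 4"
    by (simp add: l\<^sub>1_def l\<^sub>2_def power2_eq_square algebra_simps)
  also have "\<dots> = det A"
    unfolding r(2) by (simp add: det_2 power2_eq_square field_simps)
  finally have det: "l\<^sub>1 * l\<^sub>2 = det A" .
  have "z \<in> complex_eigenvalues A \<longleftrightarrow> (z - of_real l\<^sub>1) * (z - of_real l\<^sub>2) = 0" for z
  proof -
    have "det (map_matrix complex_of_real A - mat z) =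
      z\<^sup>2 - of_real (A $ 1 $ 1 + A $ 2 $ 2) * z + of_real (det A)"
      by (simp add: det_2 mat_def map_matrix_def power2_eq_square algebra_simps)
    also have "\<dots> = (z - of_real l\<^sub>1) * (z - of_real l\<^sub>2)"
      unfolding trace[symmetric] det[symmetric]
      by (simp add: power2_eq_square algebra_simps)
    finally show ?thesis
      by (simp add: complex_eigenvalues_char_poly)
  qed
  then have "complex_eigenvalues A = {complex_of_real l\<^sub>1, complex_of_real l\<^sub>2}"
    by auto
  with order trace det show ?thesis
    by (rule that)
qed

lemma positive_spectrum_iff_det_pos_2x2:
  fixes T :: "real ^ 2 ^ 2"
  assumes "positive_matrix T"
  shows "complex_eigenvalues T \<subseteq> complex_of_real ` {0<..} \<longleftrightarrow> det T > 0"
proof -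
  have nonneg: "0 \<le> T $ i $ j" for i j
    using assms by (simp add: positive_matrix_def)
  obtain l\<^sub>1 l\<^sub>2 :: real where l: "l\<^sub>1 + l\<^sub>2 = T $ 1 $ 1 + T $ 2 $ 2" "l\<^sub>1 * l\<^sub>2 = det T"
    "complex_eigenvalues T = {complex_of_real l\<^sub>1, complex_of_real l\<^sub>2}"
    using nonneg complex_eigenvalues_2x2[of T] by (metis mult_nonneg_nonneg)
  have "0 \<le> l\<^sub>1 + l\<^sub>2"
    using nonneg by (simp add: l(1))
  then have "0 < l\<^sub>1 \<and> 0 < l\<^sub>2 \<longleftrightarrow> 0 < l\<^sub>1 * l\<^sub>2"
    by (auto simp: zero_less_mult_iff)
  then show ?thesis
    unfolding l(2)[symmetric] l(3) by auto
qed

section \<open>Semigroups through positive matrices\<close>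

lemma matrix_add_rdistrib:
  fixes A :: "'a::semiring_1 ^ 'n ^ 'm"
  shows "(A + B) ** C = A ** C + B ** C"
  by (simp add: vec_eq_iff matrix_matrix_mult_def distrib_right sum.distrib)

text \<open>Since \<open>M\<^sup>2 = c M\<close>, the matrix \<open>M\<close> acts like the scalar \<open>c\<close> on its own range. The
  coefficient of \<open>M\<close> in the power \<open>(l I + M)\<^sup>t\<close> is therefore the divided difference of
  \<open>x \<mapsto> x\<^sup>t\<close> between \<open>l\<close> and \<open>l + c\<close>, or the derivative at \<open>l\<close> when \<open>c = 0\<close>. It is
  nonnegative because \<open>x \<mapsto> x\<^sup>t\<close> is increasing for \<open>t \<ge> 0\<close>.\<close>

lemma positive_semigroup_through_scalar_plus_quasi_idempotent:
  fixes M :: "real ^ 'n ^ 'n"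
  assumes "positive_matrix M" "M ** M = c *\<^sub>R M" "0 \<le> c" "0 < l"
  obtains S where "positive_semigroup S" "S 1 = l *\<^sub>R mat 1 + M"
proof -
  define q where "q t = (if c = 0 then t * l powr (t - 1) else ((l + c) powr t - l powr t) / c)" for t
  define S where "S t = l powr t *\<^sub>R mat 1 + q t *\<^sub>R M" for t
  \<comment> \<open>The coefficient identity for \<open>S t ** S s\<close>: the last term comes from \<open>M ** M = c *\<^sub>R M\<close>.\<close>
  have q_add: "q (t + s) = l powr t * q s + q t * l powr s + c * (q t * q s)" for t s
  proof (cases "c = 0")
    case True
    have "l powr (t + s - 1) = l powr t * l powr (s - 1)"
         "l powr (t + s - 1) = l powr (t - 1) * l powr s"
      by (simp_all add: powr_add[symmetric] algebra_simps)
    with True show ?thesis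
      by (simp add: q_def algebra_simps)
  next
    case False
    then show ?thesis
      using assms(3) by (simp add: q_def powr_add field_simps)
  qed
  have q_nonneg: "0 \<le> q t" if "0 \<le> t" for t
    using that assms(3,4) by (auto simp: q_def intro!: divide_nonneg_nonneg powr_mono2)
  have "S (t + s) = S t ** S s" for t s
  proof -
    have "S t ** S s = (l powr t * l powr s) *\<^sub>R mat 1
        + (l powr t * q s + q t * l powr s + c * (q t * q s)) *\<^sub>R M"
      by (simp add: S_def matrix_add_ldistrib matrix_add_rdistrib matrix_scalar_ac assms(2) algebra_simps
          flip: scalar_matrix_assoc)
    then show ?thesis
      by (simp add: S_def q_add powr_add)
  qed
  moreover have "S 0 = mat 1"
    using assms(3,4) by (simp add: S_def q_def)
  moreover have "continuous_on {0..} S"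
  proof -
    have "continuous_on {0..} q"
      using assms(3,4) by (cases "c = 0") (auto simp: q_def intro!: continuous_intros)
    then show ?thesis
      using assms(4) unfolding S_def by (auto intro!: continuous_intros)
  qed
  moreover have "positive_matrix (S t)" if "0 \<le> t" for t
    using assms(1) q_nonneg[OF that]
    by (auto simp: positive_matrix_def S_def mat_def)
  ultimately have "positive_semigroup S"
    by (simp add: positive_semigroup_def matrix_semigroup_def)
  moreover have "S 1 = l *\<^sub>R mat 1 + M"
    using assms(3,4) by (simp add: S_def q_def)
  ultimately show ?thesis
    by (rule that)
qed

text \<open>The matrix \<open>T - l\<^sub>2 I\<close> has eigenvalues \<open>0\<close> and \<open>l\<^sub>1 - l\<^sub>2\<close>. Shifting by the smaller
  eigenvalue makes its trace nonnegative, and its vanishing determinant forces the two diagonal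
  entries to have a nonnegative product, so neither of them is negative.\<close>

lemma embeddable_if_det_pos_2x2:
  fixes T :: "real ^ 2 ^ 2"
  assumes "positive_matrix T" "0 < det T"
  obtains S where "positive_semigroup S" "S 1 = T"
proof -
  have nonneg: "0 \<le> T $ i $ j" for i j
    using assms by (simp add: positive_matrix_def)
  obtain l\<^sub>1 l\<^sub>2 :: real where l: "l\<^sub>2 \<le> l\<^sub>1" "l\<^sub>1 + l\<^sub>2 = T $ 1 $ 1 + T $ 2 $ 2" "l\<^sub>1 * l\<^sub>2 = det T"
    using nonneg complex_eigenvalues_2x2[of T] by (metis mult_nonneg_nonneg)
  have "0 \<le> l\<^sub>1 + l\<^sub>2"
    using nonneg by (simp add: l(2))
  with assms(2) have l2_pos: "0 < l\<^sub>2"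
    unfolding l(3)[symmetric] by (auto simp: zero_less_mult_iff)
  define M where "M = T - l\<^sub>2 *\<^sub>R mat 1"
  have M: "M $ i $ j = (if i = j then T $ i $ j - l\<^sub>2 else T $ i $ j)" for i j
    by (simp add: M_def mat_def)
  have l1: "l\<^sub>1 = T $ 1 $ 1 + T $ 2 $ 2 - l\<^sub>2"
    using l(2) by simp
  have char_poly: "(T $ 1 $ 1 - l\<^sub>2) * (T $ 2 $ 2 - l\<^sub>2) = T $ 1 $ 2 * T $ 2 $ 1"
    using l(3) unfolding l1 det_2 by (simp add: algebra_simps)
  have "0 \<le> (T $ 1 $ 1 - l\<^sub>2) * (T $ 2 $ 2 - l\<^sub>2)" "0 \<le> (T $ 1 $ 1 - l\<^sub>2) + (T $ 2 $ 2 - l\<^sub>2)"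
    using nonneg l(1) by (auto simp: char_poly l1)
  then have "0 \<le> T $ 1 $ 1 - l\<^sub>2" "0 \<le> T $ 2 $ 2 - l\<^sub>2"
    by (auto simp: zero_le_mult_iff)
  then have "positive_matrix M"
    using nonneg by (auto simp: positive_matrix_def M forall_2)
  moreover have "M ** M = (l\<^sub>1 - l\<^sub>2) *\<^sub>R M"
    using char_poly
    by (simp add: vec_eq_iff forall_2 matrix_matrix_mult_def sum_2 M l1 algebra_simps)
  moreover have "0 \<le> l\<^sub>1 - l\<^sub>2"
    using l(1) by simp
  ultimately obtain S where "positive_semigroup S" "S 1 = l\<^sub>2 *\<^sub>R mat 1 + M"
    using l2_pos by (rule positive_semigroup_through_scalar_plus_quasi_idempotent)
  then show ?thesis
    using that by (simp add: M_def)
qed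

section \<open>Matrices in a semigroup\<close>

lemma continuous_on_det:
  fixes F :: "'a::topological_space \<Rightarrow> real ^ 'n ^ 'n"
  assumes "continuous_on X F"
  shows "continuous_on X (\<lambda>x. det (F x))"
  using assms unfolding det_def by (intro continuous_intros)

lemma matrix_semigroup_half:
  assumes "matrix_semigroup S" "0 \<le> t"
  shows "S (t / 2) ** S (t / 2) = S t"
  using assms unfolding matrix_semigroup_def
  by (metis field_sum_of_halves half_gt_zero_iff zero_le_divide_iff zero_le_numeral)

text \<open>If \<open>S t\<close> is singular then so are its iterated square roots \<open>S (t / 2\<^sup>n)\<close>. They tend
  to the identity, whose determinant is 1, so this contradicts continuity of the determinant.\<close>

lemma matrix_semigroup_invertible:
  fixes S :: "real \<Rightarrow> real ^ 'n ^ 'n"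
  assumes "matrix_semigroup S" "0 \<le> t"
  shows "invertible (S t)"
proof (rule ccontr)
  assume "\<not> invertible (S t)"
  then have zero: "det (S (t / 2 ^ n)) = 0" for n
  proof (induction n)
    case 0
    then show ?case by (simp add: invertible_det_nz)
  next
    case (Suc n)
    have "S (t / 2 ^ Suc n) ** S (t / 2 ^ Suc n) = S (t / 2 ^ n)"
      using matrix_semigroup_half[OF assms(1), of "t / 2 ^ n"] assms(2) by (simp add: mult.commute)
    then have "det (S (t / 2 ^ Suc n)) * det (S (t / 2 ^ Suc n)) = 0"
      using Suc by (metis det_mul)
    then show ?case by simp
  qed
  have "continuous_on {0..} (\<lambda>t. det (S t))"
    using assms(1) by (auto simp: matrix_semigroup_def intro: continuous_on_det)
  moreover have "(\<lambda>n. t / 2 ^ n) \<longlonglongrightarrow> 0"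
    using tendsto_mult[OF tendsto_const[of t] LIMSEQ_inverse_realpow_zero[of 2]]
    by (simp add: divide_inverse)
  ultimately have "(\<lambda>n. det (S (t / 2 ^ n))) \<longlonglongrightarrow> det (S 0)"
    using assms(2) by (auto intro: continuous_on_tendsto_compose)
  then have "(\<lambda>n. 0) \<longlonglongrightarrow> (1 :: real)"
    using assms(1) by (simp add: zero matrix_semigroup_def)
  then show False
    by (simp add: LIMSEQ_const_iff)
qed

lemma invertible_square_det_pos:
  fixes R :: "real ^ 'n ^ 'n"
  assumes "invertible (R ** R)"
  shows "0 < det (R ** R)"
  using assms by (auto simp: invertible_det_nz det_mul zero_less_mult_iff)

section \<open>The equivalence\<close>

theorem theorem4p1:
  fixes T :: "real ^ 2 ^ 2"
  assumes "positive_matrix T"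
  shows "((\<exists>S :: real \<Rightarrow> real ^ 2 ^ 2. positive_semigroup S \<and> S 1 = T) \<longleftrightarrow>
          (invertible T \<and> (\<exists>R :: real ^ 2 ^ 2. positive_matrix R \<and> R ** R = T))) \<and>
         ((invertible T \<and> (\<exists>R :: real ^ 2 ^ 2. positive_matrix R \<and> R ** R = T)) \<longleftrightarrow>
          complex_eigenvalues T \<subseteq> complex_of_real ` {0<..}) \<and>
         (complex_eigenvalues T \<subseteq> complex_of_real ` {0<..} \<longleftrightarrow> det T > 0)"
proof -
  have "invertible T \<and> (\<exists>R. positive_matrix R \<and> R ** R = T)"
    if "positive_semigroup S" "S 1 = T" for S
    using that matrix_semigroup_invertible[of S 1] matrix_semigroup_half[of S 1]
    unfolding positive_semigroup_def by (metis zero_le_one zero_le_divide_1_iff zero_le_numeral)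
  moreover have "det T > 0" if "invertible T" "R ** R = T" for R
    using that invertible_square_det_pos by auto
  moreover have "\<exists>S. positive_semigroup S \<and> S 1 = T" if "det T > 0"
    using embeddable_if_det_pos_2x2[OF assms that] by blast
  ultimately show ?thesis
    using positive_spectrum_iff_det_pos_2x2[OF assms] by metis
qed

end
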